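(* $H^1=H^1_{2s}+H^1_{\delta,0}$, and the norms $\|f\|_{H^1}$ and $\|f\|_{H^1_{2s}+H^1_{\delta,0}}$ are equivalent, i.e. there are absolute constants $c_1,c_2>0$ such that $c_1\|f\|_{H^1}\le\|f\|_{H^1_{2s}+H^1_{\delta,0}}\le c_2\|f\|_{H^1}$ for all $f\in H^1$.
   Context: All functions are on $\mathbb{R}$. An atom with defining interval $I$ (a bounded interval) is a function $a$ with $\operatorname{supp}(a)\subseteq I$, $|a(x)|\le 1/|I|$ and $\int_I a(x)\,dx=0$. $H^1=H^1(\mathbb{R})$ is the Banach space of all $f=\sum_{j=1}^\infty\lambda_j a_j$ (convergence in $L^1$ and in the sense of distributions) with $a_j$ atoms and $\sum_j|\lambda_j|<\infty$, normed by $\|f\|_{H^1}=\inf\sum_j|\lambda_j|$, the infimum being over all such decompositions of $f$. $H^1_{2s}$ (two-sided $H^1$) is defined in the same way, with its own atomic norm $\|\cdot\|_{H^1_{2s}}$, but using only atoms whose defining interval lies on one side of the origin, i.e. is contained in $(-\infty,0]$ or in $[0,\infty)$. For $n\in\mathbb{Z}$ let $$b_{n,0}=\frac{1}{2^{n+1}}\left[\chi_{[-2^n,\,0]}-\chi_{[0,\,2^n]}\right].$$ $H^1_{\delta,0}$ is the Banach space of all $\varphi=\sum_{j=1}^\infty\lambda_j b_{n_j,0}$ with $n_j\in\mathbb{Z}$ and $\sum_j|\lambda_j|<\infty$, normed by $\|\varphi\|_{H^1_{\delta,0}}=\inf\sum_j|\lambda_j|$ over all such representations. For Banach spaces $B_0,B_1$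 of integrable functions, $B_0+B_1=\{f_0+f_1:f_i\in B_i\}$ with $\|f\|_{B_0+B_1}=\inf\{\|f_0\|_{B_0}+\|f_1\|_{B_1}: f=f_0+f_1,\ f_i\in B_i\}$. *)

theory Defs
  imports "HOL-Analysis.Analysis"
begin

(* The scalar type is any type of sort {real_normed_field, euclidean_space}; its instances
   real and complex are the two usual choices.  Elements of L^1 are represented by functions;
   every space and norm below is invariant under modification on a Lebesgue null set. *)

definition supp :: "(real \<Rightarrow> 'a::{zero,topological_space}) \<Rightarrow> real set" where
  "supp f = closure {x. f x \<noteq> 0}"

definition L1_converges ::
  "(nat \<Rightarrow> real \<Rightarrow> 'a::euclidean_space) \<Rightarrow> (real \<Rightarrow> 'a) \<Rightarrow> bool" where
  "L1_converges S f \<longleftrightarrow> integrable lebesgue f \<and> (\<forall>N. integrable lebesgue (S N)) \<and>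
     (\<lambda>N. LINT x|lebesgue. norm (S N x - f x)) \<longlonglongrightarrow> 0"

definition test_function :: "(real \<Rightarrow> real) \<Rightarrow> bool" where
  "test_function \<phi> \<longleftrightarrow> (\<forall>k. (deriv ^^ k) \<phi> differentiable_on UNIV) \<and> compact (supp \<phi>)"

(* Used only for integrable functions, acting as distributions by integration. *)
definition distr_converges ::
  "(nat \<Rightarrow> real \<Rightarrow> 'a::euclidean_space) \<Rightarrow> (real \<Rightarrow> 'a) \<Rightarrow> bool" where
  "distr_converges S f \<longleftrightarrow> (\<forall>\<phi>. test_function \<phi> \<longrightarrow>
     (\<lambda>N. LINT x|lebesgue. \<phi> x *\<^sub>R S N x) \<longlonglongrightarrow> (LINT x|lebesgue. \<phi> x *\<^sub>R f x))"

definition atomic_decomposition ::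
  "(real \<Rightarrow> 'a::{real_normed_field,euclidean_space}) set \<Rightarrow> (real \<Rightarrow> 'a) \<Rightarrow>
     (nat \<Rightarrow> 'a) \<Rightarrow> (nat \<Rightarrow> real \<Rightarrow> 'a) \<Rightarrow> bool" where
  "atomic_decomposition A f c a \<longleftrightarrow>
     (\<forall>j. a j \<in> A) \<and> summable (\<lambda>j. norm (c j)) \<and>
     L1_converges (\<lambda>N x. \<Sum>j<N. c j * a j x) f \<and>
     distr_converges (\<lambda>N x. \<Sum>j<N. c j * a j x) f"

definition atomic_space ::
  "(real \<Rightarrow> 'a::{real_normed_field,euclidean_space}) set \<Rightarrow> (real \<Rightarrow> 'a) set" where
  "atomic_space A = {f. \<exists>c a. atomic_decomposition A f c a}"

definition atomic_norm ::
  "(real \<Rightarrow> 'a::{real_normed_field,euclidean_space}) set \<Rightarrow> (real \<Rightarrow> 'a) \<Rightarrow> real" where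
  "atomic_norm A f = Inf {(\<Sum>j. norm (c j)) | c a. atomic_decomposition A f c a}"

definition atom_on :: "real set \<Rightarrow> (real \<Rightarrow> 'a::{real_normed_field,euclidean_space}) \<Rightarrow> bool" where
  "atom_on I a \<longleftrightarrow> is_interval I \<and> bounded I \<and> measure lebesgue I > 0 \<and>
     a \<in> borel_measurable lebesgue \<and> supp a \<subseteq> I \<and>
     (\<forall>x. norm (a x) \<le> 1 / measure lebesgue I) \<and>
     (LINT x:I|lebesgue. a x) = 0"

definition atoms :: "(real \<Rightarrow> 'a::{real_normed_field,euclidean_space}) set" where
  "atoms = {a. \<exists>I. atom_on I a}"

definition atoms_2s :: "(real \<Rightarrow> 'a::{real_normed_field,euclidean_space}) set" where
  "atoms_2s = {a. \<exists>I. (I \<subseteq> {..0} \<or> I \<subseteq> {0..}) \<and> atom_on I a}"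

definition b0 :: "int \<Rightarrow> real \<Rightarrow> 'a::{real_normed_field,euclidean_space}" where
  "b0 n x = of_real (1 / 2 powi (n + 1) *
     (indicator {- (2 powi n)..0} x - indicator {0..2 powi n} x))"

definition H1 :: "(real \<Rightarrow> 'a::{real_normed_field,euclidean_space}) set" where
  "H1 = atomic_space atoms"

definition H1_norm :: "(real \<Rightarrow> 'a::{real_normed_field,euclidean_space}) \<Rightarrow> real" where
  "H1_norm = atomic_norm atoms"

definition H1_2s :: "(real \<Rightarrow> 'a::{real_normed_field,euclidean_space}) set" where
  "H1_2s = atomic_space atoms_2s"

definition H1_2s_norm :: "(real \<Rightarrow> 'a::{real_normed_field,euclidean_space}) \<Rightarrow> real" where
  "H1_2s_norm = atomic_norm atoms_2s"

definition H1_delta0 :: "(real \<Rightarrow> 'a::{real_normed_field,euclidean_space}) set" where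
  "H1_delta0 = atomic_space (range b0)"

definition H1_delta0_norm :: "(real \<Rightarrow> 'a::{real_normed_field,euclidean_space}) \<Rightarrow> real" where
  "H1_delta0_norm = atomic_norm (range b0)"

definition sum_decomposition ::
  "(real \<Rightarrow> 'a) set \<Rightarrow> (real \<Rightarrow> 'a) set \<Rightarrow> (real \<Rightarrow> 'a::euclidean_space) \<Rightarrow>
     (real \<Rightarrow> 'a) \<Rightarrow> (real \<Rightarrow> 'a) \<Rightarrow> bool" where
  "sum_decomposition B0 B1 f f0 f1 \<longleftrightarrow>
     f0 \<in> B0 \<and> f1 \<in> B1 \<and> (AE x in lebesgue. f x = f0 x + f1 x)"

definition sum_space ::
  "(real \<Rightarrow> 'a) set \<Rightarrow> (real \<Rightarrow> 'a) set \<Rightarrow> (real \<Rightarrow> 'a::euclidean_space) set" where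
  "sum_space B0 B1 = {f. \<exists>f0 f1. sum_decomposition B0 B1 f f0 f1}"

definition sum_norm ::
  "(real \<Rightarrow> 'a) set \<Rightarrow> ((real \<Rightarrow> 'a) \<Rightarrow> real) \<Rightarrow> (real \<Rightarrow> 'a) set \<Rightarrow> ((real \<Rightarrow> 'a) \<Rightarrow> real) \<Rightarrow>
     (real \<Rightarrow> 'a::euclidean_space) \<Rightarrow> real" where
  "sum_norm B0 norm0 B1 norm1 f =
     Inf {norm0 f0 + norm1 f1 | f0 f1. sum_decomposition B0 B1 f f0 f1}"

end

theory Submission
  imports Defs
begin

text \<open>
  Since every two-sided atom and every \<open>b\<^bsub>n,0\<^esub>\<close> is an atom, concatenating atomic decompositions of
  \<open>f\<^sub>0\<close> and \<open>f\<^sub>1\<close> decomposes \<open>f\<^sub>0 + f\<^sub>1\<close> into atoms; this gives one inclusion, with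
  \<open>c\<^sub>1 = 1\<close> (\<open>sum_decomposition_imp_H1\<close>).

  The converse is a statement about single atoms (\<open>atom_split\<close>): every atom is almost everywhere
  of the form \<open>3 g + 3 h + m b\<^bsub>n,0\<^esub>\<close> with two-sided atoms \<open>g\<close>, \<open>h\<close> and \<open>|m| \<le> 2\<close>. Only
  an atom \<open>a\<close> whose interval \<open>I\<close> contains points on both sides of the origin needs an argument. Choose
  \<open>n\<close> with \<open>|I| \<le> 2\<^sup>n < 2|I|\<close>, so that \<open>I\<close> lies in \<open>[-2\<^sup>n, 2\<^sup>n]\<close>. The integrals of \<open>a\<close> over the
  two half-lines are opposite to each other, and those of \<open>b\<^bsub>n,0\<^esub>\<close> are \<open>1/2\<close> and \<open>-1/2\<close>; hence
  subtracting from \<open>a\<close> the multiple \<open>m b\<^bsub>n,0\<^esub>\<close>, where \<open>m\<close> is twice the integral over the left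
  half-line, leaves a function with vanishing integral on either side. It is bounded by
  \<open>2/2\<^sup>n + 1/2\<^sup>n = 3/2\<^sup>n\<close>, so each of its two halves is three times an atom. Inserting this into
  an atomic decomposition of \<open>f\<close> gives \<open>c\<^sub>2 = 3 + 3 + 2 = 8\<close> (\<open>H1_imp_sum_decomposition\<close>).

  Decompositions are manipulated pointwise. If the building blocks have \<open>L\<^sup>1\<close>-norm at most one and
  the coefficients are absolutely summable, then convergence of the series to \<open>f\<close> in \<open>L\<^sup>1\<close> and in
  the sense of distributions amounts to convergence to \<open>f\<close> almost everywhere
  (\<open>atomic_decomposition_iff_AE_sums\<close>).
\<close>

section \<open>Series of functions in the unit ball of \<open>L\<^sup>1\<close>\<close>

text \<open>Membership in the closed unit ball of \<open>L\<^sup>1\<close>. It is the only property of atoms on which the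
  convergence of atomic series depends.\<close>

definition in_L1_unit_ball :: "(real \<Rightarrow> 'a::{real_normed_field,euclidean_space}) \<Rightarrow> bool" where
  "in_L1_unit_ball a \<longleftrightarrow> integrable lebesgue a \<and> (LINT x|lebesgue. norm (a x)) \<le> 1"

text \<open>By monotone convergence the series of norms has a finite integral, so it is finite almost
  everywhere.\<close>

lemma AE_summable_norm_if_summable_integral:
  fixes f :: "nat \<Rightarrow> 'b \<Rightarrow> 'c::{banach, second_countable_topology}"
  assumes f: "\<And>i. integrable M (f i)"
    and sum: "summable (\<lambda>i. LINT x|M. norm (f i x))"
  shows "AE x in M. summable (\<lambda>i. norm (f i x))"
proof -
  have [measurable]: "f i \<in> borel_measurable M" for i
    using f by auto
  have "(\<integral>\<^sup>+x. (\<Sum>i. ennreal (norm (f i x))) \<partial>M) = (\<Sum>i. \<integral>\<^sup>+x. norm (f i x) \<partial>M)"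
    by (rule nn_integral_suminf) auto
  also have "\<dots> = (\<Sum>i. ennreal (LINT x|M. norm (f i x)))"
    by (intro suminf_cong nn_integral_eq_integral integrable_norm f) auto
  also have "\<dots> \<noteq> top"
    by (rule ennreal_suminf_neq_top[OF sum]) simp
  finally have "AE x in M. (\<Sum>i. ennreal (norm (f i x))) \<noteq> top"
    unfolding infinity_ennreal_def[symmetric]
    by (rule nn_integral_PInf_AE[rotated]) measurable
  then show ?thesis
  proof eventually_elim
    case (elim x)
    then show ?case
      by (rule summable_suminf_not_top[OF norm_ge_zero])
  qed
qed

context
  fixes c :: "nat \<Rightarrow> 'a::{real_normed_field,euclidean_space}" and a :: "nat \<Rightarrow> real \<Rightarrow> 'a"
  assumes a: "\<And>j. in_L1_unit_ball (a j)" and c: "summable (\<lambda>j. norm (c j))"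
begin

lemma term_integrable: "integrable lebesgue (\<lambda>x. c j * a j x)"
  using a[of j] by (auto simp: in_L1_unit_ball_def)

lemma summable_term_norms: "summable (\<lambda>j. LINT x|lebesgue. norm (c j * a j x))"
proof (rule summable_comparison_test'[OF c])
  fix j
  have "norm (c j) * (LINT x|lebesgue. norm (a j x)) \<le> norm (c j) * 1"
    using a[of j] by (intro mult_left_mono) (auto simp: in_L1_unit_ball_def)
  then show "norm (LINT x|lebesgue. norm (c j * a j x)) \<le> norm (c j)"
    by (simp add: norm_mult)
qed

lemma AE_summable_terms: "AE x in lebesgue. summable (\<lambda>j. norm (c j * a j x))"
  by (rule AE_summable_norm_if_summable_integral[OF term_integrable summable_term_norms])

text \<open>Dominated convergence; the distance between a partial sum and the pointwise sum is at most
  twice the sum of the norms.\<close>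

lemma L1_converges_suminf:
  "L1_converges (\<lambda>N x. \<Sum>j<N. c j * a j x) (\<lambda>x. \<Sum>j. c j * a j x)"
  unfolding L1_converges_def
proof (intro conjI allI)
  show int: "integrable lebesgue (\<lambda>x. \<Sum>j. c j * a j x)"
    by (rule integrable_suminf[OF term_integrable AE_summable_terms summable_term_norms])
  show int': "integrable lebesgue (\<lambda>x. \<Sum>j<N. c j * a j x)" for N
    by (intro Bochner_Integration.integrable_sum term_integrable)
  let ?w = "\<lambda>x. 2 * (\<Sum>j. norm (c j * a j x))"
  have "integrable lebesgue (\<lambda>x. \<Sum>j. norm (c j * a j x))"
    using integrable_norm[OF term_integrable] AE_summable_terms summable_term_norms
    by (intro integrable_suminf) (simp_all only: real_norm_def abs_norm_cancel)
  then have w: "integrable lebesgue ?w"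
    by simp
  have "(\<lambda>N. LINT x|lebesgue. norm ((\<Sum>j<N. c j * a j x) - (\<Sum>j. c j * a j x)))
      \<longlonglongrightarrow> (LINT (x::real)|lebesgue. (0::real))"
  proof (rule integral_dominated_convergence[where w = ?w])
    show "integrable lebesgue ?w"
      by (rule w)
    show "(\<lambda>x. norm ((\<Sum>j<N. c j * a j x) - (\<Sum>j. c j * a j x))) \<in> borel_measurable lebesgue" for N
      by (rule borel_measurable_integrable[OF integrable_norm[OF
          Bochner_Integration.integrable_diff[OF int' int]]])
    show "AE x in lebesgue. (\<lambda>N. norm ((\<Sum>j<N. c j * a j x) - (\<Sum>j. c j * a j x))) \<longlonglongrightarrow> 0"
      using AE_summable_terms
    proof eventually_elim
      case (elim x)
      then have "(\<lambda>N. \<Sum>j<N. c j * a j x) \<longlonglongrightarrow> (\<Sum>j. c j * a j x)"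
        by (rule summable_LIMSEQ[OF summable_norm_cancel])
      then show ?case
        by (intro tendsto_norm_zero) (simp add: LIM_zero)
    qed
    show "AE x in lebesgue. norm (norm ((\<Sum>j<N. c j * a j x) - (\<Sum>j. c j * a j x))) \<le> ?w x" for N
      using AE_summable_terms
    proof eventually_elim
      case (elim x)
      have "norm (\<Sum>j<N. c j * a j x) \<le> (\<Sum>j<N. norm (c j * a j x))"
        by (rule norm_sum)
      also have "\<dots> \<le> (\<Sum>j. norm (c j * a j x))"
        by (rule sum_le_suminf[OF elim]) simp_all
      finally show ?case
        using summable_norm[OF elim] norm_triangle_ineq4[of "\<Sum>j<N. c j * a j x" "\<Sum>j. c j * a j x"]
        by simp
    qed
  qed simp
  then show "(\<lambda>N. LINT x|lebesgue. norm ((\<Sum>j<N. c j * a j x) - (\<Sum>j. c j * a j x))) \<longlonglongrightarrow> 0"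
    by simp
qed

end

lemma L1_converges_unique_AE:
  fixes f g :: "real \<Rightarrow> 'a::euclidean_space"
  assumes f: "L1_converges S f" and g: "L1_converges S g"
  shows "AE x in lebesgue. f x = g x"
proof -
  have int: "integrable lebesgue f" "integrable lebesgue g" "integrable lebesgue (S N)" for N
    using f g by (auto simp: L1_converges_def)
  let ?d = "LINT x|lebesgue. norm (f x - g x)"
  have "(\<lambda>N. (LINT x|lebesgue. norm (S N x - f x)) + (LINT x|lebesgue. norm (S N x - g x))) \<longlonglongrightarrow> 0 + 0"
    using f g unfolding L1_converges_def by (intro tendsto_add) auto
  then have lim: "(\<lambda>N. (LINT x|lebesgue. norm (S N x - f x)) + (LINT x|lebesgue. norm (S N x - g x))) \<longlonglongrightarrow> 0"
    by simp
  have le: "?d \<le> (LINT x|lebesgue. norm (S N x - f x)) + (LINT x|lebesgue. norm (S N x - g x))" for N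
  proof -
    have "?d \<le> (LINT x|lebesgue. norm (S N x - f x) + norm (S N x - g x))"
    proof (rule integral_mono)
      fix x
      show "norm (f x - g x) \<le> norm (S N x - f x) + norm (S N x - g x)"
        using norm_triangle_ineq4[of "S N x - g x" "S N x - f x"] by (simp add: add.commute)
    qed (use int in auto)
    then show ?thesis
      using int by simp
  qed
  have "?d \<le> 0"
    by (rule LIMSEQ_le_const[OF lim]) (use le in blast)
  then have "?d = 0"
    by (simp add: antisym)
  then have "AE x in lebesgue. norm (f x - g x) = 0"
    by (subst (asm) integral_nonneg_eq_0_iff_AE) (use int in auto)
  then show ?thesis
    by simp
qed

lemma L1_converges_cong_AE:
  fixes f g :: "real \<Rightarrow> 'a::euclidean_space"
  assumes f: "L1_converges S f" and fg: "AE x in lebesgue. f x = g x"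
  shows "L1_converges S g"
proof -
  have int: "integrable lebesgue f" "integrable lebesgue (S N)" for N
    using f by (auto simp: L1_converges_def)
  have g: "g \<in> borel_measurable lebesgue"
    using borel_measurable_AE[OF _ fg] int by auto
  have "integrable lebesgue g"
    using integrable_cong_AE_imp[OF int(1) g fg] .
  moreover have "(LINT x|lebesgue. norm (S N x - g x)) = (LINT x|lebesgue. norm (S N x - f x))" for N
    by (rule integral_cong_AE) (use int(1) int(2)[of N] g fg in auto)
  ultimately show ?thesis
    using f by (simp add: L1_converges_def)
qed

section \<open>Atomic decompositions as almost everywhere convergent series\<close>

lemma test_function_bounded_continuous:
  assumes "test_function \<phi>"
  obtains B where "\<And>x. \<bar>\<phi> x\<bar> \<le> B" "continuous_on UNIV \<phi>"
proof -
  have "\<phi> differentiable_on UNIV"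
    using assms unfolding test_function_def by (metis funpow_0)
  then have cont: "continuous_on UNIV \<phi>"
    by (rule differentiable_imp_continuous_on)
  have "compact (supp \<phi>)"
    using assms by (simp add: test_function_def)
  then have "bounded (\<phi> ` supp \<phi>)"
    by (intro compact_imp_bounded compact_continuous_image continuous_on_subset[OF cont]) auto
  then obtain B where "0 < B" "\<forall>y\<in>\<phi> ` supp \<phi>. norm y \<le> B"
    unfolding bounded_pos by blast
  then have B: "0 < B" "\<And>x. x \<in> supp \<phi> \<Longrightarrow> \<bar>\<phi> x\<bar> \<le> B"
    by simp_all
  have "\<bar>\<phi> x\<bar> \<le> B" for x
  proof (cases "\<phi> x = 0")
    case False
    then have "x \<in> supp \<phi>"
      unfolding supp_def using closure_subset[of "{x. \<phi> x \<noteq> 0}"] by (simp add: subset_iff)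
    then show ?thesis
      by (rule B)
  qed (use B(1) in simp)
  then show thesis
    using cont by (rule that)
qed

lemma L1_converges_imp_distr_converges:
  fixes f :: "real \<Rightarrow> 'a::euclidean_space"
  assumes f: "L1_converges S f"
  shows "distr_converges S f"
  unfolding distr_converges_def
proof (intro allI impI)
  fix \<phi> assume "test_function \<phi>"
  then obtain B where B: "\<And>x. \<bar>\<phi> x\<bar> \<le> B" and cont: "continuous_on UNIV \<phi>"
    using test_function_bounded_continuous by blast
  have int: "integrable lebesgue f" "integrable lebesgue (S N)" for N
    using f by (auto simp: L1_converges_def)
  have "\<phi> \<in> borel_measurable borel"
    using cont by (rule borel_measurable_continuous_onI)
  then have [measurable]: "\<phi> \<in> borel_measurable lebesgue"
    by (simp add: measurable_completion)
  have prod: "integrable lebesgue (\<lambda>x. \<phi> x *\<^sub>R h x)" if h: "integrable lebesgue h" for h :: "real \<Rightarrow> 'a"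
  proof (rule Bochner_Integration.integrable_bound)
    show "integrable lebesgue (\<lambda>x. B * norm (h x))"
      using h by simp
    show "(\<lambda>x. \<phi> x *\<^sub>R h x) \<in> borel_measurable lebesgue"
      using h by measurable
    show "AE x in lebesgue. norm (\<phi> x *\<^sub>R h x) \<le> norm (B * norm (h x))"
      using B by (auto simp: abs_mult intro!: mult_right_mono order_trans[OF B abs_ge_self])
  qed
  have le: "norm ((LINT x|lebesgue. \<phi> x *\<^sub>R S N x) - (LINT x|lebesgue. \<phi> x *\<^sub>R f x))
      \<le> B * (LINT x|lebesgue. norm (S N x - f x))" for N
  proof -
    have "(LINT x|lebesgue. \<phi> x *\<^sub>R S N x) - (LINT x|lebesgue. \<phi> x *\<^sub>R f x)
        = (LINT x|lebesgue. \<phi> x *\<^sub>R (S N x - f x))"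
      using prod int by (simp add: scaleR_diff_right)
    also have "norm \<dots> \<le> (LINT x|lebesgue. norm (\<phi> x *\<^sub>R (S N x - f x)))"
      by (rule integral_norm_bound)
    also have "\<dots> \<le> (LINT x|lebesgue. B * norm (S N x - f x))"
    proof (rule integral_mono)
      show "norm (\<phi> x *\<^sub>R (S N x - f x)) \<le> B * norm (S N x - f x)" for x
        using B by (simp add: mult_right_mono)
      show "integrable lebesgue (\<lambda>x. norm (\<phi> x *\<^sub>R (S N x - f x)))"
        using int by (intro integrable_norm prod Bochner_Integration.integrable_diff)
    qed (use int in auto)
    finally show ?thesis
      by simp
  qed
  have "(\<lambda>N. B * (LINT x|lebesgue. norm (S N x - f x))) \<longlonglongrightarrow> 0"
    using f unfolding L1_converges_def by (intro tendsto_mult_right_zero) blast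
  then have "(\<lambda>N. (LINT x|lebesgue. \<phi> x *\<^sub>R S N x) - (LINT x|lebesgue. \<phi> x *\<^sub>R f x)) \<longlonglongrightarrow> 0"
    by (rule Lim_null_comparison[OF always_eventually[OF allI[OF le]]])
  then show "(\<lambda>N. LINT x|lebesgue. \<phi> x *\<^sub>R S N x) \<longlonglongrightarrow> (LINT x|lebesgue. \<phi> x *\<^sub>R f x)"
    by (rule LIM_zero_cancel)
qed

lemma atomic_decomposition_iff_AE_sums:
  fixes f :: "real \<Rightarrow> 'a::{real_normed_field,euclidean_space}"
  assumes A: "\<And>a. a \<in> A \<Longrightarrow> in_L1_unit_ball a"
  shows "atomic_decomposition A f c a \<longleftrightarrow>
    (\<forall>j. a j \<in> A) \<and> summable (\<lambda>j. norm (c j)) \<and> (AE x in lebesgue. (\<lambda>j. c j * a j x) sums f x)"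
    (is "_ \<longleftrightarrow> ?R")
proof
  assume d: "atomic_decomposition A f c a"
  then have a: "\<And>j. in_L1_unit_ball (a j)" and c: "summable (\<lambda>j. norm (c j))"
    using A by (auto simp: atomic_decomposition_def)
  have "AE x in lebesgue. (\<Sum>j. c j * a j x) = f x"
    using d L1_converges_unique_AE[OF L1_converges_suminf[where a = a and c = c, OF a c]]
    by (auto simp: atomic_decomposition_def)
  with AE_summable_terms[where a = a and c = c, OF a c] have "AE x in lebesgue. (\<lambda>j. c j * a j x) sums f x"
  proof eventually_elim
    case (elim x)
    then show ?case
      using summable_sums[OF summable_norm_cancel[OF elim(1)]] by simp
  qed
  then show ?R
    using d by (auto simp: atomic_decomposition_def)
next
  assume R: ?R
  then have a: "\<And>j. in_L1_unit_ball (a j)" and c: "summable (\<lambda>j. norm (c j))"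
    using A by auto
  have "AE x in lebesgue. (\<Sum>j. c j * a j x) = f x"
    using R by (auto simp: sums_iff elim: eventually_mono)
  then have "L1_converges (\<lambda>N x. \<Sum>j<N. c j * a j x) f"
    by (rule L1_converges_cong_AE[OF L1_converges_suminf[where a = a and c = c, OF a c]])
  then show "atomic_decomposition A f c a"
    using R L1_converges_imp_distr_converges by (auto simp: atomic_decomposition_def)
qed

lemma atomic_decomposition_suminf:
  fixes c :: "nat \<Rightarrow> 'a::{real_normed_field,euclidean_space}"
  assumes A: "\<And>a. a \<in> A \<Longrightarrow> in_L1_unit_ball a"
    and a: "\<And>j. a j \<in> A" and c: "summable (\<lambda>j. norm (c j))"
  shows "atomic_decomposition A (\<lambda>x. \<Sum>j. c j * a j x) c a"
proof -
  have "L1_converges (\<lambda>N x. \<Sum>j<N. c j * a j x) (\<lambda>x. \<Sum>j. c j * a j x)"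
    by (rule L1_converges_suminf) (use A a c in simp_all)
  then show ?thesis
    using L1_converges_imp_distr_converges a c by (simp add: atomic_decomposition_def)
qed

section \<open>Sums of decompositions and the atomic norm\<close>

lemma sums_interleave:
  fixes f g :: "nat \<Rightarrow> 'b::real_normed_vector"
  assumes f: "f sums s" and g: "g sums t"
  shows "(\<lambda>n. if even n then f (n div 2) else g (n div 2)) sums (s + t)"
proof -
  have "(\<lambda>n. if even n then f (n div 2) else 0) sums s"
    by (subst sums_mono_reindex[of "\<lambda>n. 2 * n", symmetric])
       (use f in \<open>auto simp: strict_mono_def elim!: evenE\<close>)
  moreover have "(\<lambda>n. if odd n then g (n div 2) else 0) sums t"
    by (subst sums_mono_reindex[of "\<lambda>n. 2 * n + 1", symmetric])
       (use g in \<open>auto simp: strict_mono_def elim!: oddE\<close>)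
  ultimately have "(\<lambda>n. (if even n then f (n div 2) else 0) + (if odd n then g (n div 2) else 0)) sums (s + t)"
    by (rule sums_add)
  then show ?thesis
    by (rule sums_cong[THEN iffD1, rotated]) simp
qed

text \<open>The two decompositions are interleaved, the first one at the even indices and the second one
  at the odd indices.\<close>

lemma atomic_decomposition_add:
  fixes f :: "real \<Rightarrow> 'a::{real_normed_field,euclidean_space}"
  assumes A: "\<And>a. a \<in> A \<Longrightarrow> in_L1_unit_ball a"
    and sub: "A0 \<subseteq> A" "A1 \<subseteq> A"
    and d0: "atomic_decomposition A0 f0 c0 a0" and d1: "atomic_decomposition A1 f1 c1 a1"
    and f: "AE x in lebesgue. f x = f0 x + f1 x"
  obtains c a where "atomic_decomposition A f c a"
    "(\<Sum>j. norm (c j)) = (\<Sum>j. norm (c0 j)) + (\<Sum>j. norm (c1 j))"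
proof
  define c where "c = (\<lambda>n::nat. if even n then c0 (n div 2) else c1 (n div 2))"
  define a where "a = (\<lambda>n::nat. if even n then a0 (n div 2) else a1 (n div 2))"
  have D0: "\<forall>j. a0 j \<in> A0" "summable (\<lambda>j. norm (c0 j))"
      "AE x in lebesgue. (\<lambda>j. c0 j * a0 j x) sums f0 x"
    using d0 A sub by (subst (asm) atomic_decomposition_iff_AE_sums; blast)+
  have D1: "\<forall>j. a1 j \<in> A1" "summable (\<lambda>j. norm (c1 j))"
      "AE x in lebesgue. (\<lambda>j. c1 j * a1 j x) sums f1 x"
    using d1 A sub by (subst (asm) atomic_decomposition_iff_AE_sums; blast)+
  have "(\<lambda>j. norm (c j)) = (\<lambda>n. if even n then norm (c0 (n div 2)) else norm (c1 (n div 2)))"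
    by (auto simp: c_def)
  then have c: "(\<lambda>j. norm (c j)) sums ((\<Sum>j. norm (c0 j)) + (\<Sum>j. norm (c1 j)))"
    using sums_interleave[OF summable_sums[OF D0(2)] summable_sums[OF D1(2)]] by simp
  then show "(\<Sum>j. norm (c j)) = (\<Sum>j. norm (c0 j)) + (\<Sum>j. norm (c1 j))"
    by (simp add: sums_iff)
  have "AE x in lebesgue. (\<lambda>j. c j * a j x) sums f x"
    using f D0(3) D1(3)
  proof eventually_elim
    case (elim x)
    have "(\<lambda>j. c j * a j x) =
        (\<lambda>n. if even n then c0 (n div 2) * a0 (n div 2) x else c1 (n div 2) * a1 (n div 2) x)"
      by (auto simp: c_def a_def)
    then show ?case
      using sums_interleave[OF elim(2,3)] elim(1) by simp
  qed
  moreover have "\<forall>j. a j \<in> A"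
    using D0(1) D1(1) sub by (auto simp: a_def)
  ultimately show "atomic_decomposition A f c a"
    using sums_summable[OF c] atomic_decomposition_iff_AE_sums[OF A] by simp
qed

lemma atomic_norm_le:
  "atomic_decomposition A f c a \<Longrightarrow> atomic_norm A f \<le> (\<Sum>j. norm (c j))"
  unfolding atomic_norm_def
proof (rule cInf_lower)
  show "bdd_below {\<Sum>j. norm (c j) |c a. atomic_decomposition A f c a}"
  proof (rule bdd_belowI)
    fix r assume "r \<in> {\<Sum>j. norm (c j) |c a. atomic_decomposition A f c a}"
    then obtain c a where "r = (\<Sum>j. norm (c j))" "atomic_decomposition A f c a"
      by blast
    then show "0 \<le> r"
      by (simp add: suminf_nonneg atomic_decomposition_def)
  qed
qed blast

lemma le_atomic_norm:
  assumes "f \<in> atomic_space A"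
    and "\<And>c a. atomic_decomposition A f c a \<Longrightarrow> r \<le> (\<Sum>j. norm (c j))"
  shows "r \<le> atomic_norm A f"
  unfolding atomic_norm_def
proof (rule cInf_greatest)
  show "{\<Sum>j. norm (c j) |c a. atomic_decomposition A f c a} \<noteq> {}"
    using assms(1) by (simp add: atomic_space_def)
next
  fix s assume "s \<in> {\<Sum>j. norm (c j) |c a. atomic_decomposition A f c a}"
  then obtain c a where "s = (\<Sum>j. norm (c j))" "atomic_decomposition A f c a"
    by blast
  then show "r \<le> s"
    using assms(2) by simp
qed

lemma atomic_norm_nonneg: "f \<in> atomic_space A \<Longrightarrow> 0 \<le> atomic_norm A f"
  by (rule le_atomic_norm) (simp_all add: suminf_nonneg atomic_decomposition_def)

section \<open>Atoms and the functions \<open>b\<^bsub>n,0\<^esub>\<close>\<close>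

lemma atom_onD:
  fixes a :: "real \<Rightarrow> 'a::{real_normed_field,euclidean_space}"
  assumes "atom_on I a"
  shows atom_on_lmeasurable: "I \<in> lmeasurable"
    and atom_on_zero: "x \<notin> I \<Longrightarrow> a x = 0"
    and atom_on_integrable: "integrable lebesgue a"
    and atom_on_norm_integral: "(LINT x|lebesgue. norm (a x)) \<le> 1"
    and atom_on_integral: "(LINT x|lebesgue. a x) = 0"
proof -
  have pos: "measure lebesgue I > 0" and supp: "supp a \<subseteq> I"
    and bound: "\<And>x. norm (a x) \<le> 1 / measure lebesgue I"
    and int0: "(LINT x:I|lebesgue. a x) = 0"
    and [measurable]: "a \<in> borel_measurable lebesgue"
    using assms by (auto simp: atom_on_def)
  show I: "I \<in> lmeasurable"
  proof (rule fmeasurableI)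
    \<comment> \<open>A non-measurable set, or one of infinite measure, would have \<open>measure\<close> zero by convention.\<close>
    show "I \<in> sets lebesgue"
      using pos measure_notin_sets by fastforce
    show "emeasure lebesgue I < \<infinity>"
      using pos by (metis infinity_ennreal_def less_numeral_extra(3)
          top.not_eq_extremum measure_def enn2real_top)
  qed
  show zero: "a x = 0" if "x \<notin> I" for x
    using that supp closure_subset[of "{x. a x \<noteq> 0}"] unfolding supp_def by auto
  have ind: "integrable lebesgue (\<lambda>x. indicator I x / measure lebesgue I)"
    using I by (intro integrable_divide integrable_real_indicator) (auto simp: fmeasurable_def)
  have le: "norm (a x) \<le> indicator I x / measure lebesgue I" for x
    using bound[of x] zero[of x] by (cases "x \<in> I") auto
  show int: "integrable lebesgue a"
    by (rule Bochner_Integration.integrable_bound[OF ind])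
       (use le order_trans[OF le abs_ge_self] in auto)
  have "(LINT x|lebesgue. norm (a x)) \<le> (LINT x|lebesgue. indicator I x / measure lebesgue I)"
    using int ind le by (intro integral_mono) auto
  also have "\<dots> = 1"
    using pos I by simp
  finally show "(LINT x|lebesgue. norm (a x)) \<le> 1" .
  have "indicator I x *\<^sub>R a x = a x" for x
    using zero[of x] by (cases "x \<in> I") auto
  then show "(LINT x|lebesgue. a x) = 0"
    using int0 by (simp add: set_lebesgue_integral_def)
qed

lemma in_L1_unit_ball_atom:
  "a \<in> atoms \<Longrightarrow> in_L1_unit_ball a"
  by (auto simp: atoms_def in_L1_unit_ball_def intro: atom_onD)

lemma norm_b0_le:
  "norm (b0 n x :: 'a::{real_normed_field,euclidean_space}) \<le> 1 / (2 * 2 powi n)"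
  by (auto simp: b0_def power_int_add indicator_def norm_divide norm_mult norm_power_int)

lemma b0_eq_zero:
  "2 powi n < \<bar>x\<bar> \<Longrightarrow> b0 n x = 0"
  by (auto simp: b0_def indicator_def)

lemma borel_measurable_restrict_interval:
  fixes f :: "real \<Rightarrow> 'a::euclidean_space"
  shows "f \<in> borel_measurable lebesgue \<Longrightarrow>
    (\<lambda>x. indicator {p..q} x *\<^sub>R f x) \<in> borel_measurable lebesgue"
  by (intro borel_measurable_scaleR borel_measurable_indicator) auto

lemma b0_measurable:
  "(b0 n :: real \<Rightarrow> 'a::{real_normed_field,euclidean_space}) \<in> borel_measurable lebesgue"
  unfolding b0_def
  by (intro measurable_compose[OF _ borel_measurable_of_real] borel_measurable_times
      borel_measurable_diff borel_measurable_const borel_measurable_indicator) auto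

lemma AE_nonzero: "AE x in lebesgue. x \<noteq> (0::real)"
  by (intro AE_completion AE_lborel_singleton)

lemma integral_b0_left:
  "(LINT x|lebesgue. indicator {- (2 powi n)..0} x *\<^sub>R
     (b0 n x :: 'a::{real_normed_field,euclidean_space})) = 1 / 2"
proof -
  have "(LINT x|lebesgue. indicator {- (2 powi n)..0} x *\<^sub>R (b0 n x :: 'a))
      = (LINT x|lebesgue. indicator {- (2 powi n)..0::real} x *\<^sub>R (of_real (1 / 2 powi (n + 1)) :: 'a))"
  proof (rule integral_cong_AE)
    show "AE x in lebesgue. indicator {- (2 powi n)..0} x *\<^sub>R (b0 n x :: 'a)
        = indicator {- (2 powi n)..0} x *\<^sub>R of_real (1 / 2 powi (n + 1))"
      using AE_nonzero by eventually_elim (auto simp: b0_def indicator_def)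
  qed (auto intro!: borel_measurable_restrict_interval b0_measurable)
  also have "\<dots> = (2 powi n) *\<^sub>R of_real (1 / 2 powi (n + 1))"
    by (subst integral_scaleR_left) (auto simp: less_imp_le)
  also have "\<dots> = 1 / 2"
    by (simp add: power_int_add scaleR_conv_of_real)
  finally show ?thesis .
qed

lemma integral_b0_right:
  "(LINT x|lebesgue. indicator {0..2 powi n} x *\<^sub>R
     (b0 n x :: 'a::{real_normed_field,euclidean_space})) = - (1 / 2)"
proof -
  have "(LINT x|lebesgue. indicator {0..2 powi n} x *\<^sub>R (b0 n x :: 'a))
      = (LINT x|lebesgue. indicator {0..2 powi n::real} x *\<^sub>R (of_real (- 1 / 2 powi (n + 1)) :: 'a))"
  proof (rule integral_cong_AE)
    show "AE x in lebesgue. indicator {0..2 powi n} x *\<^sub>R (b0 n x :: 'a)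
        = indicator {0..2 powi n} x *\<^sub>R of_real (- 1 / 2 powi (n + 1))"
      using AE_nonzero by eventually_elim (auto simp: b0_def indicator_def)
  qed (auto intro!: borel_measurable_restrict_interval b0_measurable)
  also have "\<dots> = (2 powi n) *\<^sub>R of_real (- 1 / 2 powi (n + 1))"
    by (subst integral_scaleR_left) (auto simp: less_imp_le)
  also have "\<dots> = - (1 / 2)"
    by (simp add: power_int_add scaleR_conv_of_real)
  finally show ?thesis .
qed

text \<open>The two intervals share the origin, which is a null set.\<close>

lemma integral_split_at_zero:
  fixes f :: "real \<Rightarrow> 'a::{real_normed_field,euclidean_space}"
  assumes f: "integrable lebesgue f" and zero: "\<And>x. r < \<bar>x\<bar> \<Longrightarrow> f x = 0"
  shows "(LINT x|lebesgue. f x) =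
    (LINT x|lebesgue. indicator {-r..0} x *\<^sub>R f x) + (LINT x|lebesgue. indicator {0..r} x *\<^sub>R f x)"
proof -
  have int: "integrable lebesgue (\<lambda>x. indicator {-r..0} x *\<^sub>R f x)"
      "integrable lebesgue (\<lambda>x. indicator {0..r} x *\<^sub>R f x)"
    using f by (auto intro!: integrable_mult_indicator)
  have "(LINT x|lebesgue. f x)
      = (LINT x|lebesgue. indicator {-r..0} x *\<^sub>R f x + indicator {0..r} x *\<^sub>R f x)"
  proof (rule integral_cong_AE)
    show "AE x in lebesgue. f x = indicator {-r..0} x *\<^sub>R f x + indicator {0..r} x *\<^sub>R f x"
      using AE_nonzero
    proof eventually_elim
      case (elim x)
      then show ?case
        using zero[of x] by (cases "r < \<bar>x\<bar>") (auto simp: indicator_def)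
    qed
  qed (use f int in auto)
  then show ?thesis
    using int by simp
qed

lemma b0_atom_on:
  "atom_on {- (2 powi n)..2 powi n} (b0 n :: real \<Rightarrow> 'a::{real_normed_field,euclidean_space})"
proof -
  let ?r = "2 powi n :: real"
  have r: "?r > 0"
    by simp
  have supp: "supp (b0 n :: real \<Rightarrow> 'a) \<subseteq> {-?r..?r}"
    unfolding supp_def
  proof (rule closure_minimal)
    show "{x. b0 n x \<noteq> (0::'a)} \<subseteq> {-?r..?r}"
      using b0_eq_zero[of n] by (force simp: abs_le_iff not_less[symmetric])
  qed simp
  have int: "integrable lebesgue (b0 n :: real \<Rightarrow> 'a)"
  proof (rule integrableI_bounded_set[where A = "{-?r..?r}"])
    show "AE x in lebesgue. x \<in> {-?r..?r} \<longrightarrow> norm (b0 n x :: 'a) \<le> 1 / (2 * 2 powi n)"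
      using norm_b0_le by auto
    show "AE x in lebesgue. x \<notin> {-?r..?r} \<longrightarrow> b0 n x = (0::'a)"
      by (auto simp: b0_def)
  qed (auto intro: b0_measurable)
  have "(LINT x:{-?r..?r}|lebesgue. (b0 n x :: 'a)) = (LINT x|lebesgue. b0 n x)"
    unfolding set_lebesgue_integral_def
    by (rule Bochner_Integration.integral_cong) (auto simp: indicator_def b0_eq_zero)
  also have "\<dots> = 0"
    by (subst integral_split_at_zero[OF int, of ?r])
       (simp_all add: b0_eq_zero integral_b0_left integral_b0_right)
  finally show ?thesis
    using supp r norm_b0_le[of n, where 'a = 'a] b0_measurable[of n, where 'a = 'a]
    by (simp add: atom_on_def less_imp_le)
qed

lemma range_b0_subset_atoms: "range b0 \<subseteq> atoms"
  using b0_atom_on by (auto simp: atoms_def)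

lemma atoms_2s_subset_atoms: "atoms_2s \<subseteq> atoms"
  by (auto simp: atoms_def atoms_2s_def)

lemma atoms_2sI: "atom_on I a \<Longrightarrow> I \<subseteq> {..0} \<or> I \<subseteq> {0..} \<Longrightarrow> a \<in> atoms_2s"
  unfolding atoms_2s_def by blast

section \<open>Splitting an atom at the origin\<close>

lemma restricted_atom_on:
  fixes u :: "real \<Rightarrow> 'a::{real_normed_field,euclidean_space}"
  assumes pq: "p < q" and u: "u \<in> borel_measurable lebesgue"
    and bound: "\<And>x. norm (u x) \<le> 3 / (q - p)"
    and int0: "(LINT x|lebesgue. indicator {p..q} x *\<^sub>R u x) = 0"
  shows "atom_on {p..q} (\<lambda>x. indicator {p..q} x *\<^sub>R u x / 3)"
proof -
  let ?g = "\<lambda>x. indicator {p..q} x *\<^sub>R u x / 3"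
  have "supp ?g \<subseteq> {p..q}"
    unfolding supp_def by (rule closure_minimal) (auto simp: indicator_def)
  moreover have "norm (?g x) \<le> 1 / (q - p)" for x
    using bound[of x] pq by (auto simp: indicator_def norm_divide)
  moreover have "(LINT x:{p..q}|lebesgue. ?g x) = 0"
  proof -
    have "(LINT x:{p..q}|lebesgue. ?g x) = (LINT x|lebesgue. indicator {p..q} x *\<^sub>R u x / 3)"
      unfolding set_lebesgue_integral_def
      by (rule Bochner_Integration.integral_cong) (auto simp: indicator_def)
    then show ?thesis
      using int0 by simp
  qed
  moreover have "?g \<in> borel_measurable lebesgue"
    by (intro borel_measurable_divide borel_measurable_restrict_interval u) simp
  ultimately show ?thesis
    using pq by (simp add: atom_on_def)
qed

lemma ex_dyadic_scale:
  assumes "L > (0::real)"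
  obtains n :: int where "L \<le> 2 powi n" "2 powi n < 2 * L"
proof
  define n where "n = \<lceil>log 2 L\<rceil>"
  have eq: "2 powr real_of_int n = 2 powi n"
    by (simp add: powr_real_of_int')
  have "L = 2 powr log 2 L"
    using assms by simp
  also have "\<dots> \<le> 2 powr n"
    by (simp add: n_def)
  finally show "L \<le> 2 powi n"
    by (simp add: eq)
  have "2 powr n < 2 powr (log 2 L + 1)"
    unfolding n_def by (simp, linarith)
  also have "\<dots> = 2 * L"
    using assms by (simp add: powr_add)
  finally show "2 powi n < 2 * L"
    by (simp add: eq)
qed

lemma abs_le_measure_interval:
  assumes "is_interval I" "I \<in> lmeasurable" "0 \<in> I" "x \<in> I"
  shows "\<bar>x\<bar> \<le> measure lebesgue (I::real set)"
proof -
  let ?J = "{min 0 x..max 0 x}"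
  have "min 0 x \<in> I" "max 0 x \<in> I"
    using assms by (simp_all add: min_def max_def)
  then have "?J \<subseteq> I"
    using mem_is_interval_1_I[OF assms(1)] by (meson atLeastAtMost_iff subsetI)
  then have "measure lebesgue ?J \<le> measure lebesgue I"
    using assms(2) by (intro measure_mono_fmeasurable) auto
  then show ?thesis
    by (simp add: min_def max_def split: if_splits)
qed

text \<open>The main step: subtracting the right multiple of \<open>b\<^bsub>n,0\<^esub>\<close> leaves two one-sided functions of
  vanishing integral.\<close>

lemma straddling_atom_split:
  fixes a :: "real \<Rightarrow> 'a::{real_normed_field,euclidean_space}"
  assumes a: "atom_on I a" and I0: "0 \<in> I"
  obtains g h m n where "g \<in> atoms_2s" "h \<in> atoms_2s" "norm m \<le> 2"
    "AE x in lebesgue. a x = 3 * g x + 3 * h x + m * b0 n x"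
proof -
  define L where "L = measure lebesgue I"
  have L: "L > 0" "\<And>x. norm (a x) \<le> 1 / L" "is_interval I"
    using a by (auto simp: atom_on_def L_def)
  obtain n where n: "L \<le> 2 powi n" "2 powi n < 2 * L"
    using ex_dyadic_scale[OF L(1)] by blast
  define r where "r = (2 powi n :: real)"
  have r: "r > 0" "L \<le> r" "r < 2 * L"
    using n by (auto simp: r_def)
  have zero: "a x = 0" if "r < \<bar>x\<bar>" for x
  proof (rule atom_on_zero[OF a], rule notI)
    assume "x \<in> I"
    then have "\<bar>x\<bar> \<le> L"
      unfolding L_def by (rule abs_le_measure_interval[OF L(3) atom_on_lmeasurable[OF a] I0])
    then show False
      using that r(2) by simp
  qed
  have int: "integrable lebesgue a"
    by (rule atom_on_integrable[OF a])
  define A0 where "A0 = (LINT x|lebesgue. indicator {-r..0} x *\<^sub>R a x)"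
  define A1 where "A1 = (LINT x|lebesgue. indicator {0..r} x *\<^sub>R a x)"
  have A: "A0 + A1 = 0"
    using integral_split_at_zero[OF int zero] atom_on_integral[OF a] by (simp add: A0_def A1_def)
  have "norm A0 \<le> (LINT x|lebesgue. norm (indicator {-r..0} x *\<^sub>R a x))"
    unfolding A0_def by (rule integral_norm_bound)
  also have "\<dots> \<le> (LINT x|lebesgue. norm (a x))"
  proof (rule integral_mono)
    show "integrable lebesgue (\<lambda>x. norm (indicator {-r..0} x *\<^sub>R a x))"
      by (intro integrable_norm integrable_mult_indicator int) simp
    show "norm (indicator {-r..0} x *\<^sub>R a x) \<le> norm (a x)" for x
      by (auto simp: indicator_def)
  qed (rule integrable_norm[OF int])
  also have "\<dots> \<le> 1"
    by (rule atom_on_norm_integral[OF a])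
  finally have A0: "norm A0 \<le> 1" .
  \<comment> \<open>The factor 2 compensates for the integral of \<open>b\<^bsub>n,0\<^esub>\<close> over the left half-line being \<open>1/2\<close>.\<close>
  define m where "m = 2 * A0"
  have m: "norm m \<le> 2"
    using A0 by (simp add: m_def norm_mult)
  have intb: "integrable lebesgue (b0 n :: real \<Rightarrow> 'a)"
    by (rule atom_on_integrable[OF b0_atom_on])
  define u where "u = (\<lambda>x. a x - m * b0 n x)"
  have u_bound: "norm (u x) \<le> 3 / r" for x
  proof -
    have "norm (u x) \<le> norm (a x) + norm m * norm (b0 n x :: 'a)"
      unfolding u_def norm_mult[symmetric] by (rule norm_triangle_ineq4)
    also have "\<dots> \<le> 2 / r + 2 * (1 / (2 * r))"
    proof (intro add_mono mult_mono m)
      have "1 / L \<le> 2 / r"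
        using r L(1) by (simp add: field_simps)
      then show "norm (a x) \<le> 2 / r"
        using L(2)[of x] by linarith
      show "norm (b0 n x :: 'a) \<le> 1 / (2 * r)"
        unfolding r_def by (rule norm_b0_le)
    qed auto
    also have "\<dots> = 3 / r"
      using r by (simp add: field_simps)
    finally show ?thesis .
  qed
  have u_meas: "u \<in> borel_measurable lebesgue"
    unfolding u_def using int
    by (intro borel_measurable_diff borel_measurable_times b0_measurable) auto
  have int_u: "(LINT x|lebesgue. indicator J x *\<^sub>R u x) =
      (LINT x|lebesgue. indicator J x *\<^sub>R a x) - m * (LINT x|lebesgue. indicator J x *\<^sub>R b0 n x)"
    if "J \<in> sets lebesgue" for J
  proof -
    have "(LINT x|lebesgue. indicator J x *\<^sub>R u x) =
        (LINT x|lebesgue. indicator J x *\<^sub>R a x - m * (indicator J x *\<^sub>R b0 n x))"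
      by (rule Bochner_Integration.integral_cong) (auto simp: u_def scaleR_diff_right)
    also have "\<dots> = (LINT x|lebesgue. indicator J x *\<^sub>R a x) - m * (LINT x|lebesgue. indicator J x *\<^sub>R b0 n x)"
      using integrable_mult_indicator[OF that int] integrable_mult_indicator[OF that intb]
      by (simp del: mult_scaleR_right)
    finally show ?thesis .
  qed
  have b_left: "(LINT x|lebesgue. indicator {-r..0} x *\<^sub>R (b0 n x :: 'a)) = 1 / 2"
    unfolding r_def by (rule integral_b0_left)
  have b_right: "(LINT x|lebesgue. indicator {0..r} x *\<^sub>R (b0 n x :: 'a)) = - (1 / 2)"
    unfolding r_def by (rule integral_b0_right)
  have left: "(LINT x|lebesgue. indicator {-r..0} x *\<^sub>R u x) = 0"
    by (simp add: int_u b_left m_def flip: A0_def)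
  have right: "(LINT x|lebesgue. indicator {0..r} x *\<^sub>R u x) = 0"
    using A by (simp add: int_u b_right m_def add.commute flip: A1_def)
  define g where "g = (\<lambda>x. indicator {-r..0} x *\<^sub>R u x / 3)"
  define h where "h = (\<lambda>x. indicator {0..r} x *\<^sub>R u x / 3)"
  have "atom_on {-r..0} g"
    unfolding g_def using r(1) u_bound u_meas left by (intro restricted_atom_on) simp_all
  then have g: "g \<in> atoms_2s"
    by (rule atoms_2sI) simp
  have "atom_on {0..r} h"
    unfolding h_def using r(1) u_bound u_meas right by (intro restricted_atom_on) simp_all
  then have h: "h \<in> atoms_2s"
    by (rule atoms_2sI) simp
  have "AE x in lebesgue. a x = 3 * g x + 3 * h x + m * b0 n x"
    using AE_nonzero
  proof eventually_elim
    case (elim x)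
    have gx: "3 * g x = indicator {-r..0} x *\<^sub>R u x" and hx: "3 * h x = indicator {0..r} x *\<^sub>R u x"
      by (simp_all add: g_def h_def)
    show ?case
    proof (cases "r < \<bar>x\<bar>")
      case True
      then have "b0 n x = (0::'a)"
        unfolding r_def by (rule b0_eq_zero)
      with True show ?thesis
        unfolding gx hx using zero by (simp add: u_def)
    next
      case False
      then show ?thesis
        unfolding gx hx using elim by (auto simp: u_def indicator_def)
    qed
  qed
  with g h m show thesis
    by (rule that)
qed

lemma zero_in_atoms_2s: "(\<lambda>x. 0) \<in> atoms_2s"
proof -
  have "atom_on {0..1} (\<lambda>x. 0)"
    by (simp add: atom_on_def supp_def set_lebesgue_integral_def)
  then show ?thesis
    by (rule atoms_2sI) simp
qed

lemma atom_split:
  fixes a :: "real \<Rightarrow> 'a::{real_normed_field,euclidean_space}"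
  assumes "a \<in> atoms"
  shows "\<exists>g h m n. g \<in> atoms_2s \<and> h \<in> atoms_2s \<and> norm m \<le> 2 \<and>
    (AE x in lebesgue. a x = 3 * g x + 3 * h x + m * b0 n x)"
proof -
  obtain I where I: "atom_on I a"
    using assms by (auto simp: atoms_def)
  show ?thesis
  proof (cases "I \<subseteq> {..0} \<or> I \<subseteq> {0..}")
    case True
    \<comment> \<open>A one-sided atom is \<open>3 (a/3)\<close>, with the other two terms zero.\<close>
    have "atom_on I (\<lambda>x. a x / 3)"
    proof -
      have "supp (\<lambda>x. a x / 3) = supp a"
        by (simp add: supp_def)
      moreover have "norm (a x / 3) \<le> 1 / measure lebesgue I" for x
      proof -
        have "norm (a x) \<le> 1 / measure lebesgue I"
          using I by (simp add: atom_on_def)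
        then show ?thesis
          using norm_ge_zero[of "a x"] by (simp add: norm_divide del: norm_ge_zero)
      qed
      moreover have "(\<lambda>x. a x / 3) \<in> borel_measurable lebesgue"
      proof -
        have [measurable]: "a \<in> borel_measurable lebesgue"
          using I by (simp add: atom_on_def)
        show ?thesis
          by measurable
      qed
      ultimately show ?thesis
        using I by (simp add: atom_on_def)
    qed
    then have "(\<lambda>x. a x / 3) \<in> atoms_2s"
      using True by (rule atoms_2sI)
    then show ?thesis
      using zero_in_atoms_2s by (intro exI[of _ "\<lambda>x. a x / 3"] exI[of _ "\<lambda>x. 0"] exI[of _ 0]) simp
  next
    case False
    then obtain p q where pq: "p \<in> I" "q \<in> I" "p < 0" "0 < q"
      by (auto simp: subset_iff not_le)
    moreover have "is_interval I"
      using I by (simp add: atom_on_def)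
    ultimately have "0 \<in> I"
      unfolding is_interval_1 by (meson less_imp_le)
    then show ?thesis
      by (rule straddling_atom_split[OF I]) blast
  qed
qed


section \<open>Comparison of the two spaces and their norms\<close>

lemma H1_imp_sum_decomposition:
  fixes f :: "real \<Rightarrow> 'a::{real_normed_field,euclidean_space}"
  assumes f: "atomic_decomposition atoms f c a"
  obtains f0 f1 where "sum_decomposition H1_2s H1_delta0 f f0 f1"
    "H1_2s_norm f0 + H1_delta0_norm f1 \<le> 8 * (\<Sum>j. norm (c j))"
proof -
  have unit: "in_L1_unit_ball b" if "b \<in> atoms_2s" for b :: "real \<Rightarrow> 'a"
    using that atoms_2s_subset_atoms in_L1_unit_ball_atom by blast
  have unit_b: "in_L1_unit_ball b" if "b \<in> range b0" for b :: "real \<Rightarrow> 'a"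
    using that range_b0_subset_atoms in_L1_unit_ball_atom by blast
  have a: "a j \<in> atoms" and c: "summable (\<lambda>j. norm (c j))"
      and fx: "AE x in lebesgue. (\<lambda>j. c j * a j x) sums f x" for j
    using f atomic_decomposition_iff_AE_sums[where A = atoms and f = f and c = c and a = a]
    by (simp_all add: in_L1_unit_ball_atom)
  have "\<forall>j. \<exists>g h m n. g \<in> atoms_2s \<and> h \<in> atoms_2s \<and> norm m \<le> 2 \<and>
      (AE x in lebesgue. a j x = 3 * g x + 3 * h x + m * b0 n x)"
    by (intro allI atom_split a)
  then obtain g h m n where gh: "g j \<in> atoms_2s" "h j \<in> atoms_2s" "norm (m j) \<le> 2"
      and split: "AE x in lebesgue. a j x = 3 * g j x + 3 * h j x + m j * b0 (n j) x" for j
    unfolding choice_iff by blast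
  have c3: "summable (\<lambda>j. norm (3 * c j))" "(\<Sum>j. norm (3 * c j)) = 3 * (\<Sum>j. norm (c j))"
    using c by (simp_all add: norm_mult summable_mult suminf_mult)
  have le2: "norm (m j * c j) \<le> 2 * norm (c j)" for j
    using gh(3)[of j] by (simp add: norm_mult mult_right_mono)
  have c2: "summable (\<lambda>j. norm (m j * c j))"
    by (rule summable_comparison_test'[OF summable_mult[OF c, of 2]]) (use le2 in simp)
  have "(\<Sum>j. norm (m j * c j)) \<le> (\<Sum>j. 2 * norm (c j))"
    by (rule suminf_le[OF le2 c2 summable_mult[OF c]])
  then have c2_le: "(\<Sum>j. norm (m j * c j)) \<le> 2 * (\<Sum>j. norm (c j))"
    using c by (simp add: suminf_mult)
  define fg where "fg = (\<lambda>x. \<Sum>j. 3 * c j * g j x)"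
  define fh where "fh = (\<lambda>x. \<Sum>j. 3 * c j * h j x)"
  define f1 where "f1 = (\<lambda>x. \<Sum>j. m j * c j * b0 (n j) x)"
  have dg: "atomic_decomposition atoms_2s fg (\<lambda>j. 3 * c j) g"
    unfolding fg_def by (rule atomic_decomposition_suminf[OF unit gh(1) c3(1)])
  have dh: "atomic_decomposition atoms_2s fh (\<lambda>j. 3 * c j) h"
    unfolding fh_def by (rule atomic_decomposition_suminf[OF unit gh(2) c3(1)])
  have d1: "atomic_decomposition (range b0) f1 (\<lambda>j. m j * c j) (\<lambda>j. b0 (n j))"
    unfolding f1_def by (rule atomic_decomposition_suminf[OF unit_b rangeI c2])
  obtain c' a' where d0: "atomic_decomposition atoms_2s (\<lambda>x. fg x + fh x) c' a'"
      and c': "(\<Sum>j. norm (c' j)) = (\<Sum>j. norm (3 * c j)) + (\<Sum>j. norm (3 * c j))"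
    using atomic_decomposition_add[OF unit order_refl order_refl dg dh AE_I2[OF refl]] by blast
  have "AE x in lebesgue. f x = (fg x + fh x) + f1 x"
  proof -
    have sg: "AE x in lebesgue. (\<lambda>j. 3 * c j * g j x) sums fg x"
      using dg atomic_decomposition_iff_AE_sums[OF unit] by simp
    have sh: "AE x in lebesgue. (\<lambda>j. 3 * c j * h j x) sums fh x"
      using dh atomic_decomposition_iff_AE_sums[OF unit] by simp
    have s1: "AE x in lebesgue. (\<lambda>j. m j * c j * b0 (n j) x) sums f1 x"
      using d1 atomic_decomposition_iff_AE_sums[OF unit_b] by simp
    have "AE x in lebesgue. \<forall>j. a j x = 3 * g j x + 3 * h j x + m j * b0 (n j) x"
      using split by (simp add: AE_all_countable)
    then show ?thesis
      using fx sg sh s1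
    proof eventually_elim
      case (elim x)
      have "(\<lambda>j. (3 * c j * g j x + 3 * c j * h j x) + m j * c j * b0 (n j) x) sums ((fg x + fh x) + f1 x)"
        by (intro sums_add elim)
      also have "(\<lambda>j. (3 * c j * g j x + 3 * c j * h j x) + m j * c j * b0 (n j) x) = (\<lambda>j. c j * a j x)"
        using elim(1) by (simp add: algebra_simps)
      finally show ?case
        using elim(2) sums_unique2 by blast
    qed
  qed
  then have "sum_decomposition H1_2s H1_delta0 f (\<lambda>x. fg x + fh x) f1"
    using d0 d1 by (auto simp: sum_decomposition_def H1_2s_def H1_delta0_def atomic_space_def)
  moreover have "H1_2s_norm (\<lambda>x. fg x + fh x) + H1_delta0_norm f1 \<le> 8 * (\<Sum>j. norm (c j))"
    using atomic_norm_le[OF d0] atomic_norm_le[OF d1] c' c3(2) c2_le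
    unfolding H1_2s_norm_def H1_delta0_norm_def by linarith
  ultimately show thesis
    by (rule that)
qed

lemma sum_decomposition_imp_H1:
  fixes f :: "real \<Rightarrow> 'a::{real_normed_field,euclidean_space}"
  assumes f: "sum_decomposition H1_2s H1_delta0 f f0 f1"
  shows "f \<in> H1" and "H1_norm f \<le> H1_2s_norm f0 + H1_delta0_norm f1"
proof -
  have f0: "f0 \<in> atomic_space atoms_2s" and f1: "f1 \<in> atomic_space (range b0)"
    and eq: "AE x in lebesgue. f x = f0 x + f1 x"
    using f by (auto simp: sum_decomposition_def H1_2s_def H1_delta0_def)
  have add: "f \<in> H1 \<and> H1_norm f \<le> (\<Sum>j. norm (c0 j)) + (\<Sum>j. norm (c1 j))"
    if d: "atomic_decomposition atoms_2s f0 c0 a0" "atomic_decomposition (range b0) f1 c1 a1"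
    for c0 a0 c1 a1
  proof -
    obtain c a where "atomic_decomposition atoms f c a"
        "(\<Sum>j. norm (c j)) = (\<Sum>j. norm (c0 j)) + (\<Sum>j. norm (c1 j))"
      using atomic_decomposition_add[OF in_L1_unit_ball_atom atoms_2s_subset_atoms
          range_b0_subset_atoms d eq] by blast
    then show ?thesis
      using atomic_norm_le[of atoms f c a] by (auto simp: H1_def H1_norm_def atomic_space_def)
  qed
  show "f \<in> H1"
    using add f0 f1 unfolding atomic_space_def by blast
  \<comment> \<open>The infima over the decompositions of \<open>f0\<close> and of \<open>f1\<close> are taken one after the other.\<close>
  have "H1_norm f - (\<Sum>j. norm (c1 j)) \<le> atomic_norm atoms_2s f0"
    if "atomic_decomposition (range b0) f1 c1 a1" for c1 a1
    by (rule le_atomic_norm[OF f0]) (use add that in \<open>simp add: diff_le_eq\<close>)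
  then have "H1_norm f - atomic_norm atoms_2s f0 \<le> atomic_norm (range b0) f1"
    by (intro le_atomic_norm[OF f1]) (simp add: diff_le_eq add.commute)
  then show "H1_norm f \<le> H1_2s_norm f0 + H1_delta0_norm f1"
    by (simp add: H1_2s_norm_def H1_delta0_norm_def)
qed

lemma sum_norm_le:
  assumes "sum_decomposition H1_2s H1_delta0 f f0 f1"
  shows "sum_norm H1_2s H1_2s_norm H1_delta0 H1_delta0_norm f \<le> H1_2s_norm f0 + H1_delta0_norm f1"
  unfolding sum_norm_def
proof (rule cInf_lower)
  let ?S = "{H1_2s_norm f0 + H1_delta0_norm f1 |f0 f1. sum_decomposition H1_2s H1_delta0 f f0 f1}"
  show "bdd_below ?S"
  proof (rule bdd_belowI)
    fix r assume "r \<in> ?S"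
    then obtain f0 f1 where "r = H1_2s_norm f0 + H1_delta0_norm f1"
        "sum_decomposition H1_2s H1_delta0 f f0 f1"
      by blast
    then show "0 \<le> r"
      by (simp add: sum_decomposition_def H1_2s_def H1_2s_norm_def H1_delta0_def H1_delta0_norm_def
          atomic_norm_nonneg)
  qed
  show "H1_2s_norm f0 + H1_delta0_norm f1 \<in> ?S"
    using assms by blast
qed

lemma le_sum_norm:
  assumes "f \<in> sum_space H1_2s H1_delta0"
    and "\<And>f0 f1. sum_decomposition H1_2s H1_delta0 f f0 f1 \<Longrightarrow> r \<le> H1_2s_norm f0 + H1_delta0_norm f1"
  shows "r \<le> sum_norm H1_2s H1_2s_norm H1_delta0 H1_delta0_norm f"
  unfolding sum_norm_def
proof (rule cInf_greatest)
  let ?S = "{H1_2s_norm f0 + H1_delta0_norm f1 |f0 f1. sum_decomposition H1_2s H1_delta0 f f0 f1}"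
  show "?S \<noteq> {}"
    using assms(1) by (simp add: sum_space_def)
  show "r \<le> s" if "s \<in> ?S" for s
    using that assms(2) by blast
qed

theorem proposition2p3:
  shows "(H1 :: (real \<Rightarrow> 'a::{real_normed_field,euclidean_space}) set) = sum_space H1_2s H1_delta0 \<and>
    (\<exists>c1>0. \<exists>c2>0. \<forall>f\<in>(H1 :: (real \<Rightarrow> 'a) set).
       c1 * H1_norm f \<le> sum_norm H1_2s H1_2s_norm H1_delta0 H1_delta0_norm f \<and>
       sum_norm H1_2s H1_2s_norm H1_delta0 H1_delta0_norm f \<le> c2 * H1_norm f)"
proof (intro conjI)
  show eq: "(H1 :: (real \<Rightarrow> 'a) set) = sum_space H1_2s H1_delta0"
  proof
    show "(H1 :: (real \<Rightarrow> 'a) set) \<subseteq> sum_space H1_2s H1_delta0"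
    proof
      fix f :: "real \<Rightarrow> 'a" assume "f \<in> H1"
      then obtain c a where "atomic_decomposition atoms f c a"
        by (auto simp: H1_def atomic_space_def)
      then show "f \<in> sum_space H1_2s H1_delta0"
        using H1_imp_sum_decomposition unfolding sum_space_def by blast
    qed
    show "sum_space H1_2s H1_delta0 \<subseteq> (H1 :: (real \<Rightarrow> 'a) set)"
      using sum_decomposition_imp_H1(1) unfolding sum_space_def by blast
  qed
  have bounds: "H1_norm f \<le> sum_norm H1_2s H1_2s_norm H1_delta0 H1_delta0_norm f"
      "sum_norm H1_2s H1_2s_norm H1_delta0 H1_delta0_norm f \<le> 8 * H1_norm f"
    if f: "f \<in> H1" for f :: "real \<Rightarrow> 'a"
  proof -
    let ?s = "sum_norm H1_2s H1_2s_norm H1_delta0 H1_delta0_norm f"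
    show "H1_norm f \<le> ?s"
      using f eq sum_decomposition_imp_H1(2) by (intro le_sum_norm) simp_all
    have "?s / 8 \<le> H1_norm f"
      unfolding H1_norm_def
    proof (rule le_atomic_norm)
      show "f \<in> atomic_space atoms"
        using f by (simp add: H1_def)
      fix c a assume "atomic_decomposition atoms f c a"
      then obtain f0 f1 where "sum_decomposition H1_2s H1_delta0 f f0 f1"
          "H1_2s_norm f0 + H1_delta0_norm f1 \<le> 8 * (\<Sum>j. norm (c j))"
        by (rule H1_imp_sum_decomposition)
      then show "?s / 8 \<le> (\<Sum>j. norm (c j))"
        using sum_norm_le by fastforce
    qed
    then show "?s \<le> 8 * H1_norm f"
      by simp
  qed
  show "\<exists>c1>0. \<exists>c2>0. \<forall>f\<in>(H1 :: (real \<Rightarrow> 'a) set).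
      c1 * H1_norm f \<le> sum_norm H1_2s H1_2s_norm H1_delta0 H1_delta0_norm f \<and>
      sum_norm H1_2s H1_2s_norm H1_delta0 H1_delta0_norm f \<le> c2 * H1_norm f"
    by (rule exI[of _ 1], rule conjI, simp, rule exI[of _ 8]) (use bounds in simp)
qed

end
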